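(* Let $(k_n)_{n\in\mathbb{N}}\subseteq\mathbb{N}$ be an increasing sequence with $k_n\ge2$. Let $\{T^z\}_{z\in\mathbb{Z}^\ast}$ be a $\mathbb{Z}^\ast$-system of continuous maps of a compact metric space $(X,d)$, $\vec z=(z_n)_{n\in\mathbb{N}}\in\mathbb{Z}^\infty(\upsilon)$ and $y\in X$. Then there exist an extraction $\vec v=(v_n)_{n\in\mathbb{N}}$ of $\vec z$ and $x_0\in X$ such that $$R_2\text{-}\lim_{z\in FS[(v_n(i_n))_{n\in\mathbb{N}}]}T^z(y)=x_0,\qquad R_2\text{-}\lim_{z\in FS[(v_n(i_n))_{n\in\mathbb{N}}]}T^z(x_0)=x_0$$ uniformly for all $(i_n)_{n\in\mathbb{N}}\subseteq\mathbb{N}$ with $1\le i_n\le k_n$.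
   Context: Notation: $\mathbb{N}=\{1,2,\ldots\}$, $\mathbb{Z}^\ast=\mathbb{Z}\setminus\{0\}$. "Increasing" is in the weak sense. Words. $L$ is the set of functions $w$ from a nonempty finite set $dom(w)\subset\mathbb{N}$ to $\mathbb{N}$ with $1\le w(s)\le k_s$ for all $s\in dom(w)$. Let $\upsilon\notin\mathbb{N}$ be a symbol (variable). $L(\upsilon)$ is the set of functions $w$ from a nonempty finite $dom(w)\subset\mathbb{N}$ to $\mathbb{N}\cup\{\upsilon\}$ with each $w(s)$ either $\upsilon$ or in $\{1,\ldots,k_s\}$, taking the value $\upsilon$ at least once. For words $w,u$ with disjoint domains, $w\star u$ is the word on $dom(w)\cup dom(u)$ extending both. $w<_{R_2}u$ means $\max dom(w)<\min dom(u)$. For $w\in L(\upsilon)$ and $1\le i\le k_{\min dom(w)}$, $w(i)$ denotes $w$ with $\upsilon$ replaced by $i$; also $w(\upsilon)$, with argument the symbol $\upsilon$, denotes $w$ itself. Integers as words. Put $l_0=1$ and $l_s=(k_1+1)\cdots(k_s+1)$ for $s\in\mathbb{N}$. The map $g:L\to\mathbb{Z}^\ast$, $g(w)=\sum_{s\in dom(w)}w(s)(-1)^{s-1}l_{s-1}$, is a bijection. For $z_1,z_2\in\mathbb{Z}^\ast$, $z_1<_{R_2}z_2$ means $g^{-1}(z_1)<_{R_2}g^{-1}(z_2)$. For $w\in L(\upsilon)$, $g(w)$ denotes the function $z$ with $z(i)=g(w(i))\in\mathbb{Z}^\ast$ for $1\le i\le k_{\min dom(w)}$ (it determines $w$). $\mathbb{Z}^\infty(\upsilon)$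 is the set of sequences $\vec z=(z_n)_{n\in\mathbb{N}}$, $z_n=g(w_n)$, with $w_n\in L(\upsilon)$ and $w_n<_{R_2}w_{n+1}$ for all $n$. An extraction of $\vec z=(g(w_n))_n$ is a sequence $\vec v=(v_n)_n\in\mathbb{Z}^\infty(\upsilon)$, $v_n=g(u_n)$, with each $u_n$ of the form $w_{n_1}(p_1)\star\cdots\star w_{n_\lambda}(p_\lambda)$, where $\lambda\in\mathbb{N}$, $n_1<\cdots<n_\lambda$, each $p_l\in\{1,\ldots,k_{n_l}\}\cup\{\upsilon\}$, at least one $p_l=\upsilon$. A $\mathbb{Z}^\ast$-system of $X$ is a family $\{T^z\}_{z\in\mathbb{Z}^\ast}$ of continuous maps $X\to X$ with $T^{z_1}T^{z_2}=T^{z_1+z_2}$ whenever $z_1<_{R_2}z_2$. $FS[(x_n)_{n\in\mathbb{N}}]=\{x_{n_1}+\cdots+x_{n_\lambda}:\lambda\in\mathbb{N},n_1<\cdots<n_\lambda\}$. $R_2\text{-}\lim_{z\in D}x_z=x_0$, for $D=FS[(v_n(i_n))_n]$, means: for every neighborhood $V$ of $x_0$ there is $n_0\in\mathbb{N}$ with $x_z\in V$ for all $z\in D$ with $\min dom(g^{-1}(z))\ge n_0$. Uniformly means that, for each $V$, one $n_0$ works for all admissible sequences $(i_n)_n$. *)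

theory Defs
  imports "HOL-Analysis.Analysis"
begin

text \<open>
  The natural numbers of the source start at 1: in every sequence
  (\<open>k\<close>, \<open>z\<close>, \<open>v\<close>, \<open>i\<close>, ...) only the terms with index at least 1 are meaningful.
\<close>

datatype letter = Digit nat | Upsilon

type_synonym word = "nat \<rightharpoonup> letter"

definition alphabet :: "(nat \<Rightarrow> nat) \<Rightarrow> nat \<Rightarrow> letter set" where
  "alphabet k s = Digit ` {1..k s}"

definition words :: "(nat \<Rightarrow> nat) \<Rightarrow> word set" where
  "words k = {w. finite (dom w) \<and> dom w \<noteq> {} \<and> dom w \<subseteq> {1..} \<and>
                 (\<forall>s\<in>dom w. the (w s) \<in> alphabet k s)}"

definition var_words :: "(nat \<Rightarrow> nat) \<Rightarrow> word set" where
  "var_words k = {w. finite (dom w) \<and> dom w \<noteq> {} \<and> dom w \<subseteq> {1..} \<and>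
                     (\<forall>s\<in>dom w. the (w s) \<in> insert Upsilon (alphabet k s)) \<and>
                     Upsilon \<in> ran w}"

definition word_less :: "word \<Rightarrow> word \<Rightarrow> bool" where
  "word_less w u \<longleftrightarrow> Max (dom w) < Min (dom u)"

text \<open>\<open>subst w p\<close> is $w(p)$; in particular \<open>subst w Upsilon = w\<close>.\<close>

definition subst :: "word \<Rightarrow> letter \<Rightarrow> word" where
  "subst w p = (\<lambda>s. map_option (\<lambda>a. if a = Upsilon then p else a) (w s))"

definition l :: "(nat \<Rightarrow> nat) \<Rightarrow> nat \<Rightarrow> nat" where
  "l k s = (\<Prod>j=1..s. (k j + 1))"

text \<open>The value at \<open>Upsilon\<close> is a dummy: \<open>g\<close> is only applied to words without variable.\<close>

primrec digit :: "letter \<Rightarrow> nat" where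
  "digit (Digit a) = a"
| "digit Upsilon = 0"

definition g :: "(nat \<Rightarrow> nat) \<Rightarrow> word \<Rightarrow> int" where
  "g k w = (\<Sum>s\<in>dom w. int (digit (the (w s))) * (-1) ^ (s - 1) * int (l k (s - 1)))"

definition g_inv :: "(nat \<Rightarrow> nat) \<Rightarrow> int \<Rightarrow> word" where
  "g_inv k = inv_into (words k) (g k)"

definition int_less :: "(nat \<Rightarrow> nat) \<Rightarrow> int \<Rightarrow> int \<Rightarrow> bool" where
  "int_less k z1 z2 \<longleftrightarrow> word_less (g_inv k z1) (g_inv k z2)"

text \<open>
  The function $i \mapsto g(w(i))$ attached to a variable word, with domain
  $\{1,\ldots,k_{\min dom(w)}\}$ (extensional outside it).
\<close>

definition g_var :: "(nat \<Rightarrow> nat) \<Rightarrow> word \<Rightarrow> nat \<Rightarrow> int" where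
  "g_var k w = (\<lambda>i\<in>{1..k (Min (dom w))}. g k (subst w (Digit i)))"

definition var_word_seqs :: "(nat \<Rightarrow> nat) \<Rightarrow> (nat \<Rightarrow> word) set" where
  "var_word_seqs k = {w. \<forall>n\<ge>1. w n \<in> var_words k \<and> word_less (w n) (w (n + 1))}"

definition Z_inf :: "(nat \<Rightarrow> nat) \<Rightarrow> (nat \<Rightarrow> nat \<Rightarrow> int) set" where
  "Z_inf k = {z. \<exists>w\<in>var_word_seqs k. \<forall>n\<ge>1. z n = g_var k (w n)}"

text \<open>
  The words $w_{n_1}(p_1) \star \cdots \star w_{n_\lambda}(p_\lambda)$ with at least one $p_j$
  the variable. As the $n_j$ are distinct, $p_j$ is written \<open>p n\<close> with $n = n_j$; the domains
  are pairwise disjoint, so that $\star$ is \<open>++\<close>.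
\<close>

definition extracted_words :: "(nat \<Rightarrow> nat) \<Rightarrow> (nat \<Rightarrow> word) \<Rightarrow> word set" where
  "extracted_words k w =
     {foldr (++) (map (\<lambda>n. subst (w n) (p n)) ns) Map.empty | ns p.
        ns \<noteq> [] \<and> sorted_wrt (<) ns \<and> set ns \<subseteq> {1..} \<and>
        (\<forall>n\<in>set ns. p n \<in> insert Upsilon (alphabet k n)) \<and>
        (\<exists>n\<in>set ns. p n = Upsilon)}"

definition is_extraction ::
  "(nat \<Rightarrow> nat) \<Rightarrow> (nat \<Rightarrow> nat \<Rightarrow> int) \<Rightarrow> (nat \<Rightarrow> nat \<Rightarrow> int) \<Rightarrow> bool" where
  "is_extraction k v z \<longleftrightarrow>
     (\<exists>w\<in>var_word_seqs k. \<exists>u\<in>var_word_seqs k.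
        (\<forall>n\<ge>1. z n = g_var k (w n)) \<and> (\<forall>n\<ge>1. v n = g_var k (u n)) \<and>
        (\<forall>n\<ge>1. u n \<in> extracted_words k w))"

definition Z_system ::
  "(nat \<Rightarrow> nat) \<Rightarrow> 'a topology \<Rightarrow> (int \<Rightarrow> 'a \<Rightarrow> 'a) \<Rightarrow> bool" where
  "Z_system k X T \<longleftrightarrow>
     (\<forall>z. z \<noteq> 0 \<longrightarrow> continuous_map X X (T z)) \<and>
     (\<forall>z1 z2. z1 \<noteq> 0 \<longrightarrow> z2 \<noteq> 0 \<longrightarrow> int_less k z1 z2 \<longrightarrow>
        (\<forall>x\<in>topspace X. T z1 (T z2 x) = T (z1 + z2) x))"

definition FS :: "(nat \<Rightarrow> int) \<Rightarrow> int set" where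
  "FS x = {\<Sum>n\<in>F. x n | F. finite F \<and> F \<noteq> {} \<and> F \<subseteq> {1..}}"

text \<open>
  $R_2$-$\lim_{z \in D(i)} f(z) = a$ uniformly for $i \in I$; for a single set \<open>D\<close> take \<open>I\<close> to be
  a singleton.
\<close>

definition R2_lim_uniformly ::
  "(nat \<Rightarrow> nat) \<Rightarrow> 'a topology \<Rightarrow> 'i set \<Rightarrow> ('i \<Rightarrow> int set) \<Rightarrow> (int \<Rightarrow> 'a) \<Rightarrow> 'a \<Rightarrow> bool" where
  "R2_lim_uniformly k X I D f a \<longleftrightarrow>
     (\<forall>V. (\<exists>U. openin X U \<and> a \<in> U \<and> U \<subseteq> V) \<longrightarrow>
        (\<exists>n0\<ge>1. \<forall>i\<in>I. \<forall>z\<in>D i. n0 \<le> Min (dom (g_inv k z)) \<longrightarrow> f z \<in> V))"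

definition index_seqs :: "(nat \<Rightarrow> nat) \<Rightarrow> (nat \<Rightarrow> nat) set" where
  "index_seqs k = {i. \<forall>n\<ge>1. 1 \<le> i n \<and> i n \<le> k n}"

end

theory Submission
  imports Defs
begin

text \<open>
  Closed sets of ultrafilters on the semigroup of words under \<open>++\<close> are represented by filters. An
  idempotent ultrafilter \<open>p\<close> of constant words lying in a minimal left ideal dominates an ultrafilter
  \<open>q\<close> of variable words such that every substitution \<open>w \<mapsto> w(i)\<close> maps \<open>q\<close> to \<open>p\<close>. The point \<open>x0\<close> is the
  limit along \<open>p\<close> of \<open>w \<mapsto> T\<^bsup>g(w)\<^esup>(y)\<close>, and the words of the extraction are chosen one after the other,
  by the argument of Galvin and Glazer: given a set \<open>G\<close> of \<open>p\<close>, idempotence yields \<open>u\<close> with \<open>u(i) \<in> G\<close>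
  and with \<open>{x. u(i) ++ x \<in> G}\<close> in \<open>p\<close>. The limit of \<open>T\<^sup>z(x0)\<close> follows from that of \<open>T\<^sup>z(y)\<close>, since
  \<open>T\<^sup>z(x0)\<close> is the limit over \<open>n\<close> of \<open>T\<^sup>z(T\<^bsup>v\<^esup>(y)) = T\<^bsup>z+v\<^esup>(y)\<close> with \<open>v = v\<^sub>n(1)\<close>.
\<close>

subsection \<open>Ultrafilters\<close>

text \<open>Zorn's lemma for the reversed order: a chain of proper filters has a proper infimum,
  because each finite nonempty part of the chain contains its own infimum. \<open>Q\<close> will be
  trivial (for ultrafilters), being a closed subsemigroup, and being a closed left ideal.\<close>

lemma minimal_filter:
  fixes F :: "'a filter"
  assumes "F \<noteq> bot" and "Q F"
    and Q_Inf: "\<And>C. C \<noteq> {} \<Longrightarrow> \<forall>G\<in>C. Q G \<Longrightarrow> Q (Inf C)"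
  obtains M where "M \<le> F" "M \<noteq> bot" "Q M"
    "\<And>G. G \<le> M \<Longrightarrow> G \<noteq> bot \<Longrightarrow> Q G \<Longrightarrow> G = M"
proof -
  let ?A = "{G. G \<le> F \<and> G \<noteq> bot \<and> Q G}"
  have po: "partial_order_on ?A (relation_of (\<ge>) ?A)"
    by (auto simp: partial_order_on_def preorder_on_def refl_on_def trans_def antisym_def relation_of_def)
  have "\<exists>U\<in>?A. \<forall>G\<in>C. U \<le> G" if C: "C \<in> Chains (relation_of (\<ge>) ?A)" for C
  proof (cases "C = {}")
    case True
    then show ?thesis using assms(1,2) by auto
  next
    case False
    have CA: "C \<subseteq> ?A" and lin: "\<And>G H. G \<in> C \<Longrightarrow> H \<in> C \<Longrightarrow> G \<le> H \<or> H \<le> G"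
      using C by (auto simp: Chains_def relation_of_def)
    have "Inf B \<noteq> bot" if "finite B" "B \<subseteq> C" for B
    proof (cases "B = {}")
      case False
      have "Inf B \<in> B" using that(1) False that(2)
      proof (induction B rule: finite_ne_induct)
        case (insert G B)
        then have "Inf B \<in> B" "G \<in> C" "Inf B \<in> C" by auto
        then show ?case using lin[of G "Inf B"] by (auto simp: inf.absorb1 inf.absorb2)
      qed auto
      then show ?thesis using that CA by auto
    next
      case True
      have "(top :: 'a filter) \<noteq> bot" using assms(1) le_bot[of F] top_greatest[of F] by (intro notI) simp
      with True show ?thesis by simp
    qed
    then have "Inf C \<noteq> bot" by (rule Inf_filter_not_bot)
    moreover have "Inf C \<le> F" using False CA by (auto intro: Inf_lower2)
    moreover have "Q (Inf C)" using False CA by (intro Q_Inf) auto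
    ultimately show ?thesis by (auto intro: Inf_lower)
  qed
  from predicate_Zorn[OF po this] obtain M where "M \<in> ?A" "\<forall>G\<in>?A. G \<le> M \<longrightarrow> G = M"
    by auto
  then show thesis by (intro that[of M]) auto
qed

definition ultrafilter :: "'a filter \<Rightarrow> bool" where
  "ultrafilter F \<longleftrightarrow> F \<noteq> bot \<and> (\<forall>P. eventually P F \<or> eventually (\<lambda>x. \<not> P x) F)"

text \<open>A minimal proper filter decides every predicate: adding \<open>P\<close> to it either
  makes it improper or leaves it unchanged.\<close>

lemma ultrafilter_exists:
  assumes "F \<noteq> bot"
  obtains U where "U \<le> F" "ultrafilter U"
proof -
  obtain M where M: "M \<le> F" "M \<noteq> bot"
    and min: "\<And>G. G \<le> M \<Longrightarrow> G \<noteq> bot \<Longrightarrow> G = M"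
    using minimal_filter[of F "\<lambda>_. True"] assms by auto
  have "eventually P M \<or> eventually (\<lambda>x. \<not> P x) M" for P
  proof (cases "inf M (principal {x. P x}) = bot")
    case True
    then show ?thesis
      by (simp add: trivial_limit_def eventually_inf_principal)
  next
    case False
    then have "inf M (principal {x. P x}) = M" by (intro min) auto
    then have "M \<le> principal {x. P x}" by (metis inf.cobounded2)
    then show ?thesis by (simp add: le_principal)
  qed
  with M that show thesis by (auto simp: ultrafilter_def)
qed

lemma ultrafilter_not:
  assumes "ultrafilter U"
  shows "eventually (\<lambda>x. \<not> P x) U \<longleftrightarrow> \<not> eventually P U"
proof -
  have "\<not> (eventually P U \<and> eventually (\<lambda>x. \<not> P x) U)"
    using assms by (simp add: ultrafilter_def flip: eventually_conj_iff)
  with assms show ?thesis by (auto simp: ultrafilter_def)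
qed

lemma ultrafilter_le_eq:
  assumes "ultrafilter U" "F \<le> U" "F \<noteq> bot"
  shows "F = U"
proof (rule antisym)
  show "U \<le> F"
  proof (rule filter_leI)
    fix P assume P: "eventually P F"
    show "eventually P U"
    proof (rule ccontr)
      assume "\<not> eventually P U"
      then have "eventually (\<lambda>x. \<not> P x) F"
        using ultrafilter_not[OF assms(1)] filter_leD[OF assms(2)] by blast
      with P have "eventually (\<lambda>_. False) F" by eventually_elim simp
      with assms show False by simp
    qed
  qed
qed (use assms in simp)

lemma ultrafilter_filtermap: "ultrafilter U \<Longrightarrow> ultrafilter (filtermap h U)"
  by (auto simp: ultrafilter_def eventually_filtermap filtermap_bot_iff)

text \<open>Otherwise every point has a neighbourhood that \<open>f\<close> eventually avoids;
  finitely many of them cover the space, so \<open>f\<close> would eventually avoid all of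
  it.\<close>

lemma ultrafilter_limit:
  assumes "compact_space X" "ultrafilter U" "eventually (\<lambda>x. f x \<in> topspace X) U"
  obtains a where "a \<in> topspace X" "limitin X f a U"
proof -
  have "\<exists>a\<in>topspace X. limitin X f a U"
  proof (rule ccontr)
    assume "\<not> ?thesis"
    then have "\<forall>a\<in>topspace X. \<exists>W. openin X W \<and> a \<in> W \<and> \<not> eventually (\<lambda>x. f x \<in> W) U"
      by (auto simp: limitin_def)
    then obtain W where W: "\<And>a. a \<in> topspace X \<Longrightarrow>
        openin X (W a) \<and> a \<in> W a \<and> \<not> eventually (\<lambda>x. f x \<in> W a) U"
      by metis
    have "\<exists>\<F>. finite \<F> \<and> \<F> \<subseteq> W ` topspace X \<and> topspace X \<subseteq> \<Union>\<F>"
      using assms(1) unfolding compact_space_def by (rule compactinD) (use W in auto)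
    then obtain \<F> where \<F>: "finite \<F>" "\<F> \<subseteq> W ` topspace X" "topspace X \<subseteq> \<Union>\<F>" by blast
    have "\<forall>S\<in>\<F>. eventually (\<lambda>x. f x \<notin> S) U"
      using \<F>(2) W ultrafilter_not[OF assms(2)] by fastforce
    then have "eventually (\<lambda>x. \<forall>S\<in>\<F>. f x \<notin> S) U"
      using \<F>(1) by (simp add: eventually_ball_finite)
    with assms(3) have "eventually (\<lambda>x. False) U"
      by eventually_elim (use \<F>(3) in blast)
    then show False using assms(2) by (simp add: ultrafilter_def)
  qed
  then show thesis using that by blast
qed

subsection \<open>The semigroup of ultrafilters\<close>

context semigroup
begin

text \<open>
  A filter plays the role of the closed set of ultrafilters refining it; the product extends the
  one of the Stone-Cech compactification, and is continuous in the left argument.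
\<close>

definition filter_mult :: "'a filter \<Rightarrow> 'a filter \<Rightarrow> 'a filter" where
  "filter_mult F G = Abs_filter (\<lambda>P. \<forall>\<^sub>F x in F. \<forall>\<^sub>F y in G. P (x \<^bold>* y))"

lemma eventually_filter_mult:
  "eventually P (filter_mult F G) \<longleftrightarrow> (\<forall>\<^sub>F x in F. \<forall>\<^sub>F y in G. P (x \<^bold>* y))"
  unfolding filter_mult_def
proof (rule eventually_Abs_filter, unfold_locales, goal_cases)
  case (2 P Q)
  then show ?case by eventually_elim (rule eventually_conj)
next
  case (3 P Q)
  from 3(2) show ?case by eventually_elim (use 3(1) in \<open>auto elim: eventually_mono\<close>)
qed simp

lemma filter_mult_assoc:
  "filter_mult (filter_mult F G) H = filter_mult F (filter_mult G H)"
  by (simp add: filter_eq_iff eventually_filter_mult assoc)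

lemma filter_mult_mono: "F \<le> F' \<Longrightarrow> G \<le> G' \<Longrightarrow> filter_mult F G \<le> filter_mult F' G'"
  unfolding le_filter_def eventually_filter_mult
  by (auto elim!: eventually_mono)

lemma filter_mult_eq_bot_iff: "filter_mult F G = bot \<longleftrightarrow> F = bot \<or> G = bot"
proof -
  have "filter_mult F G = bot \<longleftrightarrow> (\<forall>\<^sub>F x in F. \<forall>\<^sub>F y in G. False)"
    by (simp only: trivial_limit_def eventually_filter_mult)
  then show ?thesis by (auto simp: eventually_const_iff)
qed

lemma ultrafilter_mult:
  assumes "ultrafilter F" "ultrafilter G"
  shows "ultrafilter (filter_mult F G)"
proof -
  have "eventually (\<lambda>x. \<not> P x) (filter_mult F G) \<longleftrightarrow> \<not> eventually P (filter_mult F G)" for P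
    by (simp add: eventually_filter_mult ultrafilter_not assms)
  then show ?thesis using assms by (auto simp: ultrafilter_def filter_mult_eq_bot_iff)
qed

lemma filtermap_filter_mult:
  assumes "\<And>x y. h (x \<^bold>* y) = h x \<^bold>* h y"
  shows "filtermap h (filter_mult F G) = filter_mult (filtermap h F) (filtermap h G)"
  by (simp add: filter_eq_iff eventually_filter_mult eventually_filtermap assms)

text \<open>For ultrafilters \<open>q\<close> and \<open>r\<close> this is the closed set of
  solutions \<open>x\<close> of \<open>x q = r\<close>, the preimage of \<open>r\<close> under right
  multiplication by \<open>q\<close>.\<close>

definition filter_residual :: "'a filter \<Rightarrow> 'a filter \<Rightarrow> 'a filter" where
  "filter_residual r q = (INF P\<in>{P. eventually P r}. principal {x. \<forall>\<^sub>F y in q. P (x \<^bold>* y)})"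

lemma le_filter_residual: "F \<le> filter_residual r q \<longleftrightarrow> filter_mult F q \<le> r"
  unfolding filter_residual_def le_INF_iff le_principal le_filter_def[of "filter_mult F q"]
    eventually_filter_mult by simp

text \<open>Were the two filters incompatible, there would be \<open>Q\<close> in \<open>F\<close>
  and \<open>P\<close> in \<open>r\<close> such that for no \<open>x\<close> in \<open>Q\<close> the
  product of \<open>x\<close> with \<open>q\<close>-most \<open>y\<close> is in \<open>P\<close>. As
  \<open>q\<close> is an ultrafilter, the negation of \<open>P\<close> would belong to
  \<open>F q\<close> and hence to \<open>r\<close>.\<close>

lemma inf_filter_residual_not_bot:
  assumes "ultrafilter q" "ultrafilter r" "r \<le> filter_mult F q"
  shows "inf F (filter_residual r q) \<noteq> bot"
proof
  let ?R = "\<lambda>P. {x. \<forall>\<^sub>F y in q. P (x \<^bold>* y)}"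
  assume bot: "inf F (filter_residual r q) = bot"
  \<comment> \<open>Since \<open>?R\<close> of a conjunction lies in both of the sets
    \<open>?R P\<close> and \<open>?R Q\<close>, a single \<open>P\<close> suffices to witness
    membership in the infimum.\<close>
  have base: "eventually S (filter_residual r q) \<longleftrightarrow>
      (\<exists>P\<in>{P. eventually P r}. eventually S (principal (?R P)))" for S
    unfolding filter_residual_def
  proof (rule eventually_INF_base)
    show "{P. eventually P r} \<noteq> {}" using eventually_True by blast
    fix P Q assume "P \<in> {P. eventually P r}" "Q \<in> {P. eventually P r}"
    then show "\<exists>R\<in>{P. eventually P r}. principal (?R R) \<le> inf (principal (?R P)) (principal (?R Q))"
      by (intro bexI[of _ "\<lambda>x. P x \<and> Q x"]) (auto simp: eventually_conj elim: eventually_mono)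
  qed
  from bot have "eventually (\<lambda>_. False) (inf F (filter_residual r q))" by simp
  then obtain Q R where Q: "eventually Q F" and R: "eventually R (filter_residual r q)"
    and QR: "\<And>x. Q x \<Longrightarrow> R x \<Longrightarrow> False"
    unfolding eventually_inf by blast
  from R obtain P where P: "eventually P r" and PR: "\<And>x. (\<forall>\<^sub>F y in q. P (x \<^bold>* y)) \<Longrightarrow> R x"
    unfolding base by (auto simp: eventually_principal)
  have "eventually (\<lambda>x. \<not> P x) (filter_mult F q)"
    unfolding eventually_filter_mult ultrafilter_not[OF assms(1)]
    using Q by eventually_elim (use QR PR in blast)
  then have "eventually (\<lambda>x. \<not> P x) r" using assms(3) filter_leD by blast
  with P assms(2) show False by (simp add: ultrafilter_not)
qed

text \<open>Any ultrafilter refining both \<open>F\<close> and the residual is a solution: its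
  product with \<open>q\<close> is proper and below the ultrafilter \<open>r\<close>, hence equal to
  it.\<close>

lemma ultrafilter_le_filter_mult:
  assumes "ultrafilter q" "ultrafilter r" "r \<le> filter_mult F q"
  obtains p where "ultrafilter p" "p \<le> F" "filter_mult p q = r"
proof -
  obtain p where p: "p \<le> inf F (filter_residual r q)" "ultrafilter p"
    using ultrafilter_exists inf_filter_residual_not_bot[OF assms] by blast
  then have "filter_mult p q \<le> r" by (simp flip: le_filter_residual)
  then have "filter_mult p q = r"
    using assms p(2) by (intro ultrafilter_le_eq) (auto simp: filter_mult_eq_bot_iff ultrafilter_def)
  with p that show thesis by simp
qed

text \<open>The Ellis-Numakura lemma.\<close>

lemma idempotent_ultrafilter:
  assumes "F \<noteq> bot" "filter_mult F F \<le> F"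
  obtains q where "q \<le> F" "ultrafilter q" "filter_mult q q = q"
proof -
  obtain M where M: "M \<le> F" "M \<noteq> bot" "filter_mult M M \<le> M"
    and min: "\<And>G. G \<le> M \<Longrightarrow> G \<noteq> bot \<Longrightarrow> filter_mult G G \<le> G \<Longrightarrow> G = M"
  proof (rule minimal_filter[of F "\<lambda>G. filter_mult G G \<le> G"])
    fix C :: "'a filter set"
    assume "\<forall>G\<in>C. filter_mult G G \<le> G"
    then show "filter_mult (Inf C) (Inf C) \<le> Inf C"
      by (intro Inf_greatest) (meson Inf_lower filter_mult_mono order_trans)
  qed (use assms in auto)
  obtain q where q: "q \<le> M" "ultrafilter q" using M(2) ultrafilter_exists by blast
  \<comment> \<open>The closed subsemigroup \<open>M q\<close> of \<open>M\<close> is all of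
    \<open>M\<close> by minimality, so \<open>q\<close> itself has the form \<open>x q\<close> with
    \<open>x\<close> in \<open>M\<close>.\<close>
  have "filter_mult M q = M"
  proof (rule min)
    show le: "filter_mult M q \<le> M" using filter_mult_mono[of M M q M] q M by simp
    show "filter_mult M q \<noteq> bot" using M q by (simp add: filter_mult_eq_bot_iff ultrafilter_def)
    have "filter_mult (filter_mult M q) M \<le> M"
      using filter_mult_mono[OF le order_refl, of M] M(3) by simp
    then show "filter_mult (filter_mult M q) (filter_mult M q) \<le> filter_mult M q"
      by (metis filter_mult_assoc filter_mult_mono order_refl)
  qed
  then have nb: "inf M (filter_residual q q) \<noteq> bot"
    using inf_filter_residual_not_bot q by metis
  let ?H = "inf M (filter_residual q q)"
  \<comment> \<open>The solutions in \<open>M\<close> of \<open>x q = q\<close> form a nonempty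
    closed subsemigroup, so they exhaust \<open>M\<close> and include \<open>q\<close>.\<close>
  have "?H = M"
  proof (rule min)
    have "filter_mult ?H q \<le> q" by (simp flip: le_filter_residual)
    then have "filter_mult (filter_mult ?H ?H) q \<le> q"
      by (metis filter_mult_assoc filter_mult_mono order_refl order_trans)
    moreover have "filter_mult ?H ?H \<le> M"
      by (rule order_trans[OF filter_mult_mono M(3)]) auto
    ultimately show "filter_mult ?H ?H \<le> ?H" by (simp add: le_filter_residual)
  qed (use nb in auto)
  then have "filter_mult q q \<le> q" using q(1) by (metis inf.cobounded2 le_filter_residual order_trans)
  then have "filter_mult q q = q"
    using q by (intro ultrafilter_le_eq) (auto simp: filter_mult_eq_bot_iff ultrafilter_def)
  with q M that show thesis by (meson order_trans)
qed

text \<open>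
  \<open>L\<close> and \<open>V\<close> stand for the closed semigroups of constant and of variable words, and \<open>h i\<close> for the
  substitution of \<open>i\<close>. With \<open>p\<close> idempotent in a minimal left ideal of \<open>L\<close>, one takes \<open>q\<close>
  idempotent in \<open>V\<close> with \<open>q \<le> p\<close> in the order of idempotents; then \<open>h i\<close> maps \<open>q\<close> to an idempotent
  below \<open>p\<close>, that is to \<open>p\<close> itself.
\<close>

lemma substitution_ultrafilters:
  assumes nb: "L \<noteq> bot" "V \<noteq> bot"
    and LL: "filter_mult L L \<le> L" and LV: "filter_mult L V \<le> V"
    and VL: "filter_mult V L \<le> V" and VV: "filter_mult V V \<le> V"
    and hom: "\<And>i x y. h i (x \<^bold>* y) = h i x \<^bold>* h i y"
    and hV: "\<And>i. i \<in> I \<Longrightarrow> filtermap (h i) V \<le> L"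
    and hL: "\<And>i. eventually (\<lambda>x. h i x = x) L"
  obtains p q where "ultrafilter p" "p \<le> L" "filter_mult p p = p" "ultrafilter q" "q \<le> V"
    "\<And>i. i \<in> I \<Longrightarrow> filtermap (h i) q = p"
proof -
  obtain M where M: "M \<le> L" "M \<noteq> bot" "filter_mult L M \<le> M"
    and min: "\<And>G. G \<le> M \<Longrightarrow> G \<noteq> bot \<Longrightarrow> filter_mult L G \<le> G \<Longrightarrow> G = M"
  proof (rule minimal_filter[of L "\<lambda>G. filter_mult L G \<le> G"])
    fix C :: "'a filter set"
    assume "\<forall>G\<in>C. filter_mult L G \<le> G"
    then show "filter_mult L (Inf C) \<le> Inf C"
      by (intro Inf_greatest) (meson Inf_lower filter_mult_mono order_refl order_trans)
  qed (use nb LL in auto)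
  \<comment> \<open>Every single ultrafilter in the minimal left ideal generates it.\<close>
  have ideal: "filter_mult L s = M" if "s \<le> M" "ultrafilter s" for s
  proof (rule min)
    show "filter_mult L s \<le> M" using filter_mult_mono[of L L s M] that M by simp
    show "filter_mult L s \<noteq> bot" using nb that by (simp add: filter_mult_eq_bot_iff ultrafilter_def)
    show "filter_mult L (filter_mult L s) \<le> filter_mult L s"
      using filter_mult_mono[OF LL order_refl] by (simp flip: filter_mult_assoc)
  qed
  have "filter_mult M M \<le> M"
    using filter_mult_mono[of M L M M] M by simp
  then obtain p where p: "p \<le> M" "ultrafilter p" "filter_mult p p = p"
    using M idempotent_ultrafilter by blast
  have pL: "p \<le> L" using p M by simp
  \<comment> \<open>\<open>V p\<close> is a closed semigroup inside \<open>V\<close>. An idempotent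
    \<open>e = t p\<close> in it satisfies \<open>e p = e\<close>, because \<open>p\<close> is
    idempotent.\<close>
  have "filter_mult (filter_mult V p) (filter_mult V p) \<le> filter_mult V p"
  proof -
    have "filter_mult (filter_mult V p) V \<le> V"
      using filter_mult_mono[OF order_trans[OF filter_mult_mono[OF order_refl pL] VL] order_refl, of V] VV
      by (rule order_trans)
    then show ?thesis by (metis filter_mult_assoc filter_mult_mono order_refl)
  qed
  moreover have "filter_mult V p \<noteq> bot"
    using nb p by (simp add: filter_mult_eq_bot_iff ultrafilter_def)
  ultimately obtain e where e: "e \<le> filter_mult V p" "ultrafilter e" "filter_mult e e = e"
    using idempotent_ultrafilter by blast
  obtain t where t: "ultrafilter t" "t \<le> V" "filter_mult t p = e"
    using ultrafilter_le_filter_mult[OF p(2) e(2,1)] .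
  \<comment> \<open>So far only \<open>e p = e\<close> holds. Multiplying by \<open>p\<close> on the
    left gives an idempotent with \<open>p q = q = q p\<close>, that is, one below
    \<open>p\<close>.\<close>
  define q where "q = filter_mult p e"
  have ep: "filter_mult e p = e" by (metis t(3) filter_mult_assoc p(3))
  have qq: "filter_mult q q = q" unfolding q_def by (metis e(3) ep filter_mult_assoc)
  have pq: "filter_mult p q = q" unfolding q_def by (metis filter_mult_assoc p(3))
  have qp: "filter_mult q p = q" unfolding q_def by (metis filter_mult_assoc ep)
  have uq: "ultrafilter q" unfolding q_def by (intro ultrafilter_mult p e)
  have "e \<le> V" using order_trans[OF e(1) order_trans[OF filter_mult_mono[OF order_refl pL] VL]] .
  then have qV: "q \<le> V" unfolding q_def using order_trans[OF filter_mult_mono[OF pL] LV] by blast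
  have "filtermap (h i) q = p" if i: "i \<in> I" for i
  proof -
    let ?q = "filtermap (h i) q"
    have hp: "filtermap (h i) p = p"
      unfolding filter_eq_iff eventually_filtermap
      by (intro allI eventually_subst eventually_mono[OF filter_leD[OF pL hL[of i]]]) simp
    have qq': "filter_mult ?q ?q = ?q" using filtermap_filter_mult[of "h i", OF hom] qq by metis
    have pq': "filter_mult p ?q = ?q" using filtermap_filter_mult[of "h i", OF hom] pq hp by metis
    have qp': "filter_mult ?q p = ?q" using filtermap_filter_mult[of "h i", OF hom] qp hp by metis
    have uq': "ultrafilter ?q" using uq by (rule ultrafilter_filtermap)
    have "?q \<le> L" using filtermap_mono[OF qV] hV[OF i] by (rule order_trans)
    then have "filter_mult ?q p \<le> filter_mult L p" by (intro filter_mult_mono) auto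
    then have "?q \<le> M" unfolding qp' using ideal[OF p(1,2)] by simp
    \<comment> \<open>As \<open>?q\<close> lies in the minimal ideal it generates that ideal, so
      \<open>p = s ?q\<close> for some \<open>s\<close>. Then
      \<open>p ?q = s ?q ?q = s ?q = p\<close>, whereas \<open>p ?q = ?q\<close>.\<close>
    then have "p \<le> filter_mult L ?q" using ideal uq' p(1) by simp
    then obtain s where "filter_mult s ?q = p" using ultrafilter_le_filter_mult uq' p(2) by metis
    then have "filter_mult p ?q = p" by (metis filter_mult_assoc qq')
    with pq' show ?thesis by simp
  qed
  with that p pL uq qV show thesis by blast
qed

end

text \<open>The Galvin-Glazer recursion: \<open>G (Suc n)\<close> is cut out of \<open>G n\<close>
  by the translation conditions for \<open>u n\<close>, finitely many because \<open>I n\<close> is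
  finite, and so stays in \<open>p\<close>. \<open>E\<close> constrains single terms,
  \<open>R\<close> consecutive ones, and \<open>A n\<close> is the target set at stage
  \<open>n\<close>.\<close>

lemma (in semigroup) substitution_sequence:
  fixes p q :: "'a filter" and A :: "nat \<Rightarrow> 'a \<Rightarrow> bool"
  assumes idem: "filter_mult p p = p" and "q \<noteq> bot"
    and hq: "\<And>n i. i \<in> I n \<Longrightarrow> filtermap (h i) q = p" and fin: "\<And>n. finite (I n)"
    and A: "\<And>n. eventually (A n) p" and E: "\<And>n. eventually (E n) q" and R: "\<And>x. eventually (R x) q"
  obtains u G where "\<And>n. E n (u n)" "\<And>n. R (u n) (u (Suc n))" "\<And>n x. G n x \<Longrightarrow> A n x"
    "\<And>n x. G (Suc n) x \<Longrightarrow> G n x" "\<And>n i. i \<in> I n \<Longrightarrow> G n (h i (u n))"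
    "\<And>n i x. i \<in> I n \<Longrightarrow> G (Suc n) x \<Longrightarrow> G n (h i (u n) \<^bold>* x)"
proof -
  \<comment> \<open>By idempotence \<open>p\<close>-most \<open>x\<close> lie in \<open>G\<close>
    and carry \<open>p\<close>-most \<open>y\<close> into \<open>G\<close>. Each \<open>h i\<close>
    maps \<open>q\<close> to \<open>p\<close>, so \<open>q\<close>-most \<open>x\<close> have this
    property after every substitution from \<open>I n\<close>.\<close>
  have step: "\<exists>x. S x \<and> (\<forall>i\<in>I n. G (h i x) \<and> (\<forall>\<^sub>F y in p. G (h i x \<^bold>* y)))"
    if "eventually G p" "eventually S q" for n S G
  proof -
    have *: "\<forall>\<^sub>F x in p. G x \<and> (\<forall>\<^sub>F y in p. G (x \<^bold>* y))"
      using that(1) idem eventually_filter_mult[of G p p] by (simp add: eventually_conj_iff)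
    have "\<forall>\<^sub>F x in q. G (h i x) \<and> (\<forall>\<^sub>F y in p. G (h i x \<^bold>* y))" if "i \<in> I n" for i
    proof -
      have "\<forall>\<^sub>F x in filtermap (h i) q. G x \<and> (\<forall>\<^sub>F y in p. G (x \<^bold>* y))"
        using * by (simp only: hq[OF that])
      then show ?thesis by (simp only: eventually_filtermap)
    qed
    then have "\<forall>\<^sub>F x in q. S x \<and> (\<forall>i\<in>I n. G (h i x) \<and> (\<forall>\<^sub>F y in p. G (h i x \<^bold>* y)))"
      using fin that(2) by (intro eventually_conj eventually_ball_finite) auto
    then show ?thesis using assms(2) eventually_happens by blast
  qed
  \<comment> \<open>The recursion runs on pairs of a term and a set of \<open>p\<close>:
    \<open>P\<close> is the invariant of a stage, \<open>Q\<close> links consecutive stages.\<close>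
  define P where "P n c \<longleftrightarrow> E n (fst c) \<and> eventually (snd c) p \<and> (\<forall>x. snd c x \<longrightarrow> A n x) \<and>
      (\<forall>i\<in>I n. snd c (h i (fst c)) \<and> (\<forall>\<^sub>F y in p. snd c (h i (fst c) \<^bold>* y)))"
    for n and c :: "'a \<times> ('a \<Rightarrow> bool)"
  define Q where "Q n c c' \<longleftrightarrow> R (fst c) (fst c') \<and>
      (\<forall>x. snd c' x \<longrightarrow> snd c x \<and> (\<forall>i\<in>I n. snd c (h i (fst c) \<^bold>* x)))"
    for n and c c' :: "'a \<times> ('a \<Rightarrow> bool)"
  have "\<exists>c. \<forall>n. P n (c n) \<and> Q n (c n) (c (Suc n))"
  proof (rule dependent_nat_choice)
    obtain x where "E 0 x" "\<forall>i\<in>I 0. A 0 (h i x) \<and> (\<forall>\<^sub>F y in p. A 0 (h i x \<^bold>* y))"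
      using step[OF A[of 0] E[of 0]] by blast
    then have "P 0 (x, A 0)" using A by (simp add: P_def)
    then show "\<exists>c. P 0 c" ..
  next
    fix c n assume c: "P n c"
    \<comment> \<open>All three conditions hold \<open>p\<close>-eventually: the old set by the
      invariant, its translates by the choice of the old term, and the new target by
      assumption.\<close>
    define G where "G x \<longleftrightarrow> snd c x \<and> (\<forall>i\<in>I n. snd c (h i (fst c) \<^bold>* x)) \<and> A (Suc n) x" for x
    have G: "eventually G p"
      unfolding G_def using c A fin by (auto simp: P_def intro!: eventually_conj eventually_ball_finite)
    obtain x where "R (fst c) x \<and> E (Suc n) x"
      "\<forall>i\<in>I (Suc n). G (h i x) \<and> (\<forall>\<^sub>F y in p. G (h i x \<^bold>* y))"
      using step[OF G eventually_conj[OF R[of "fst c"] E[of "Suc n"]], of "Suc n"] by blast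
    then have "P (Suc n) (x, G) \<and> Q n c (x, G)" using G by (simp add: P_def Q_def G_def)
    then show "\<exists>c'. P (Suc n) c' \<and> Q n c c'" ..
  qed
  then obtain c where "\<And>n. P n (c n) \<and> Q n (c n) (c (Suc n))" by blast
  then show thesis
    by (intro that[of "\<lambda>n. fst (c n)" "\<lambda>n. snd (c n)"]) (auto simp: P_def Q_def)
qed

subsection \<open>Reduced words\<close>

lemma dom_subst [simp]: "dom (subst w p) = dom w"
  by (auto simp: subst_def dom_def)

lemma subst_map_add: "subst (x ++ y) p = subst x p ++ subst y p"
  by (auto simp: subst_def map_add_def split: option.split)

lemma subst_subst: "subst (subst w p) q = subst w (if p = Upsilon then q else p)"
  by (rule ext) (simp add: subst_def option.map_comp comp_def if_distrib cong: if_cong)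

lemma subst_id: "Upsilon \<notin> ran w \<Longrightarrow> subst w p = w"
  by (rule ext) (auto simp: subst_def ran_def map_option_case split: option.split)

lemma Upsilon_in_ran_subst: "Upsilon \<in> ran (subst w p) \<longleftrightarrow> Upsilon \<in> ran w \<and> p = Upsilon"
  by (auto simp: subst_def ran_def split: if_splits)

section \<open>Products of substituted words\<close>

definition star :: "(nat \<Rightarrow> word) \<Rightarrow> nat list \<Rightarrow> (nat \<Rightarrow> letter) \<Rightarrow> word" where
  "star w ns p = foldr (++) (map (\<lambda>n. subst (w n) (p n)) ns) Map.empty"

lemma star_Nil [simp]: "star w [] p = Map.empty"
  by (simp add: star_def)

lemma star_Cons [simp]: "star w (n # ns) p = subst (w n) (p n) ++ star w ns p"
  by (simp add: star_def)

lemma star_append: "star w (ms @ ns) p = star w ms p ++ star w ns p"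
  by (induction ms) auto

lemma star_cong: "(\<And>n. n \<in> set ns \<Longrightarrow> p n = q n) \<Longrightarrow> star w ns p = star w ns q"
  by (induction ns) auto

lemma dom_star: "dom (star w ns p) = (\<Union>n\<in>set ns. dom (w n))"
  by (induction ns) auto

lemma subst_star: "subst (star w ns p) q = star w ns (\<lambda>n. if p n = Upsilon then q else p n)"
proof (induction ns)
  case Nil
  show ?case by (simp add: subst_def)
qed (simp add: subst_map_add subst_subst)

lemma var_word_seq_mem:
  "w \<in> var_word_seqs k \<Longrightarrow> 1 \<le> n \<Longrightarrow> w n \<in> var_words k"
  by (simp add: var_word_seqs_def)

lemma word_less_Max:
  assumes "word_less x y" "finite (dom x)" "finite (dom y)" "s \<in> dom x" "t \<in> dom y"
  shows "s < t"
  using assms Max_ge[of "dom x" s] Min_le[of "dom y" t] unfolding word_less_def by linarith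

lemma word_lessI:
  assumes "finite (dom x)" "finite (dom y)" "dom x \<noteq> {}" "dom y \<noteq> {}"
    "\<And>s t. s \<in> dom x \<Longrightarrow> t \<in> dom y \<Longrightarrow> s < t"
  shows "word_less x y"
  unfolding word_less_def using assms Max_in[of "dom x"] Min_in[of "dom y"] by blast

lemma var_word_seq_dom_less:
  assumes w: "w \<in> var_word_seqs k" and m: "1 \<le> m" and s: "s \<in> dom (w m)"
  shows "t \<in> dom (w (Suc m + j)) \<Longrightarrow> s < t"
proof (induction j arbitrary: t)
  case 0
  have "word_less (w m) (w (m + 1))" using w m by (simp add: var_word_seqs_def)
  then show ?case
    using 0 s var_word_seq_mem[OF w, of m] var_word_seq_mem[OF w, of "m + 1"] m
    by (auto simp: var_words_def intro: word_less_Max)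
next
  case (Suc j)
  have mem: "w (Suc m + j) \<in> var_words k" "w (Suc m + Suc j) \<in> var_words k"
    using var_word_seq_mem[OF w] by auto
  then obtain r where r: "r \<in> dom (w (Suc m + j))" unfolding var_words_def by blast
  have "word_less (w (Suc m + j)) (w (Suc m + Suc j))" using w by (simp add: var_word_seqs_def)
  then have "r < t"
    using mem r Suc.prems unfolding var_words_def by (blast intro: word_less_Max)
  with Suc.IH[OF r] show ?case by simp
qed

lemma var_word_seq_less:
  assumes "w \<in> var_word_seqs k" "1 \<le> m" "m < n" "s \<in> dom (w m)" "t \<in> dom (w n)"
  shows "s < t"
  using var_word_seq_dom_less[OF assms(1,2,4), of t "n - Suc m"] assms by simp

lemma var_word_seq_disjoint:
  assumes "w \<in> var_word_seqs k" "1 \<le> m" "1 \<le> n" "m \<noteq> n"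
  shows "dom (w m) \<inter> dom (w n) = {}"
proof -
  have "m < n \<or> n < m" using assms(4) by linarith
  then show ?thesis
    using var_word_seq_less[OF assms(1,2), of n] var_word_seq_less[OF assms(1,3), of m] by blast
qed

text \<open>The minima of the domains increase strictly, starting from at least 1. With
  \<open>k\<close> increasing, a letter allowed at index \<open>n\<close> is therefore allowed at
  every position of \<open>w n\<close>.\<close>

lemma var_word_seq_ge:
  assumes w: "w \<in> var_word_seqs k" and "1 \<le> n" "s \<in> dom (w n)"
  shows "n \<le> s"
  using assms(2,3)
proof (induction n arbitrary: s rule: dec_induct)
  case base
  then show ?case using var_word_seq_mem[OF w, of 1] by (auto simp: var_words_def)
next
  case (step n)
  obtain r where "r \<in> dom (w n)" using var_word_seq_mem[OF w step(1)] unfolding var_words_def by blast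
  then show ?case using step var_word_seq_less[OF w step(1), of "Suc n" r s] by fastforce
qed

lemma star_apply:
  assumes w: "w \<in> var_word_seqs k"
  shows "set ns \<subseteq> {1..} \<Longrightarrow> n \<in> set ns \<Longrightarrow> s \<in> dom (w n) \<Longrightarrow> star w ns p s = subst (w n) (p n) s"
proof (induction ns)
  case (Cons m ns)
  show ?case
  proof (cases "s \<in> dom (star w ns p)")
    case True
    then obtain n' where "n' \<in> set ns" "s \<in> dom (w n')" by (auto simp: dom_star)
    moreover from this have "n' = n"
      using var_word_seq_disjoint[OF w, of n' n] Cons.prems by (auto simp del: One_nat_def)
    ultimately show ?thesis using Cons True by (auto simp: map_add_dom_app_simps)
  next
    case False
    then have "n = m" using Cons.prems by (auto simp: dom_star)
    with False show ?thesis by (simp add: map_add_dom_app_simps)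
  qed
qed simp

lemma Upsilon_in_ran_star:
  assumes w: "w \<in> var_word_seqs k" and ns: "set ns \<subseteq> {1..}"
  shows "Upsilon \<in> ran (star w ns p) \<longleftrightarrow> (\<exists>n\<in>set ns. p n = Upsilon)"
proof
  assume "Upsilon \<in> ran (star w ns p)"
  then obtain s where s: "star w ns p s = Some Upsilon" by (auto simp: ran_def)
  then obtain n where n: "n \<in> set ns" "s \<in> dom (w n)" using dom_star[of w ns p] by blast
  then have "subst (w n) (p n) s = Some Upsilon" using star_apply[OF w ns n] s by simp
  then have "p n = Upsilon" by (auto simp: subst_def split: if_splits)
  with n show "\<exists>n\<in>set ns. p n = Upsilon" by blast
next
  assume "\<exists>n\<in>set ns. p n = Upsilon"
  then obtain n where n: "n \<in> set ns" "p n = Upsilon" by blast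
  then obtain s where s: "w n s = Some Upsilon"
    using var_word_seq_mem[OF w, of n] ns by (force simp: var_words_def ran_def)
  then have "star w ns p s = Some Upsilon"
    using star_apply[OF w ns n(1), of s p] n by (auto simp: subst_def)
  then show "Upsilon \<in> ran (star w ns p)" by (rule ranI)
qed

lemma star_letters:
  assumes w: "w \<in> var_word_seqs k" and k: "mono_on {1..} k" and ns: "set ns \<subseteq> {1..}"
    and p: "\<forall>n\<in>set ns. p n \<in> insert Upsilon (alphabet k n)" and s: "s \<in> dom (star w ns p)"
  shows "the (star w ns p s) \<in> insert Upsilon (alphabet k s)"
proof -
  obtain n where n: "n \<in> set ns" "s \<in> dom (w n)" using s by (auto simp: dom_star)
  have n1: "1 \<le> n" using n ns by auto
  then have "k n \<le> k s" using mono_onD[OF k, of n s] var_word_seq_ge[OF w n1 n(2)] by simp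
  then have "p n \<in> insert Upsilon (alphabet k s)" using p n(1) by (auto simp: alphabet_def)
  moreover have "the (w n s) \<in> insert Upsilon (alphabet k s)"
    using var_word_seq_mem[OF w n1] n by (simp add: var_words_def)
  ultimately show ?thesis using star_apply[OF w ns n, of p] n(2) by (auto simp: subst_def split: if_splits)
qed

lemma star_dom:
  assumes w: "w \<in> var_word_seqs k" and "ns \<noteq> []" and ns: "set ns \<subseteq> {N..}" and "1 \<le> N"
  shows "finite (dom (star w ns p))" "dom (star w ns p) \<noteq> {}" "dom (star w ns p) \<subseteq> {N..}"
proof -
  have 1: "1 \<le> n \<and> N \<le> n" if "n \<in> set ns" for n using that ns \<open>1 \<le> N\<close> by auto
  then have mem: "w n \<in> var_words k" if "n \<in> set ns" for n using var_word_seq_mem[OF w] that by simp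
  show "finite (dom (star w ns p))" using mem by (auto simp: dom_star var_words_def)
  show "dom (star w ns p) \<noteq> {}"
    using \<open>ns \<noteq> []\<close> mem[of "hd ns"] by (auto simp: dom_star var_words_def intro!: bexI[of _ "hd ns"])
  show "dom (star w ns p) \<subseteq> {N..}"
  proof
    fix s assume "s \<in> dom (star w ns p)"
    then obtain n where "n \<in> set ns" "s \<in> dom (w n)" unfolding dom_star by blast
    then show "s \<in> {N..}" using 1 var_word_seq_ge[OF w, of n s] by fastforce
  qed
qed

lemma star_in_words:
  assumes w: "w \<in> var_word_seqs k" and k: "mono_on {1..} k" and "ns \<noteq> []" and ns: "set ns \<subseteq> {1..}"
    and p: "\<forall>n\<in>set ns. p n \<in> alphabet k n"
  shows "star w ns p \<in> words k"
proof -
  have "Upsilon \<notin> ran (star w ns p)"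
    using p by (auto simp: Upsilon_in_ran_star[OF w ns] alphabet_def)
  then have "\<forall>s\<in>dom (star w ns p). the (star w ns p s) \<noteq> Upsilon" by (auto simp: ran_def)
  moreover have "\<forall>s\<in>dom (star w ns p). the (star w ns p s) \<in> insert Upsilon (alphabet k s)"
    using star_letters[OF w k ns] p by blast
  ultimately show ?thesis using star_dom[OF w assms(3) ns order_refl, of p] by (auto simp: words_def)
qed

text \<open>Constant and variable words are kept together, so that one argument serves products of
  both kinds. \<open>N\<close> bounds the indices from below and thereby, for \<open>N\<close> at
  least 1, also the positions.\<close>

definition reduced_words :: "(nat \<Rightarrow> nat) \<Rightarrow> (nat \<Rightarrow> word) \<Rightarrow> nat \<Rightarrow> word set" where
  "reduced_words k w N = {star w ns p | ns p. ns \<noteq> [] \<and> sorted_wrt (<) ns \<and> set ns \<subseteq> {N..} \<and>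
     (\<forall>n\<in>set ns. p n \<in> insert Upsilon (alphabet k n))}"

lemma reduced_words_extracted:
  assumes w: "w \<in> var_word_seqs k" and "x \<in> reduced_words k w N" "1 \<le> N" "Upsilon \<in> ran x"
  shows "x \<in> extracted_words k w"
proof -
  obtain ns p where x: "x = star w ns p" and *: "ns \<noteq> []" "sorted_wrt (<) ns" "set ns \<subseteq> {N..}"
     "\<forall>n\<in>set ns. p n \<in> insert Upsilon (alphabet k n)"
    using assms(2) by (auto simp: reduced_words_def)
  have ns: "set ns \<subseteq> {1..}" using *(3) \<open>1 \<le> N\<close> by auto
  then have "\<exists>n\<in>set ns. p n = Upsilon" using Upsilon_in_ran_star[OF w] assms(4) x by blast
  with * ns x show ?thesis unfolding extracted_words_def star_def by blast
qed

lemma reduced_words_dom: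
  assumes "w \<in> var_word_seqs k" "x \<in> reduced_words k w N" "1 \<le> N"
  shows "finite (dom x)" "dom x \<noteq> {}" "dom x \<subseteq> {N..}"
  using assms(2) star_dom[OF assms(1) _ _ assms(3)] unfolding reduced_words_def by blast+

lemma reduced_words_cases:
  assumes w: "w \<in> var_word_seqs k" and k: "mono_on {1..} k" and x: "x \<in> reduced_words k w N" "1 \<le> N"
  shows "x \<in> (if Upsilon \<in> ran x then var_words k else words k)"
proof -
  obtain ns p where *: "x = star w ns p" "ns \<noteq> []" "sorted_wrt (<) ns" "set ns \<subseteq> {N..}"
     "\<forall>n\<in>set ns. p n \<in> insert Upsilon (alphabet k n)"
    using x by (auto simp: reduced_words_def)
  have ns: "set ns \<subseteq> {1..}" using *(4) \<open>1 \<le> N\<close> by auto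
  have "\<forall>s\<in>dom x. the (x s) \<in> insert Upsilon (alphabet k s)"
    using star_letters[OF w k ns *(5)] *(1) by blast
  moreover have "dom x \<subseteq> {1..}" using reduced_words_dom(3)[OF w x] x(2) by auto
  moreover have "Upsilon \<in> ran x" if "s \<in> dom x" "the (x s) = Upsilon" for s
    using that by (auto simp: ran_def)
  ultimately show ?thesis
    using reduced_words_dom[OF w x] by (auto simp: var_words_def words_def)
qed

lemma reduced_words_mono: "M \<le> N \<Longrightarrow> reduced_words k w N \<subseteq> reduced_words k w M"
proof
  fix x assume "M \<le> N" "x \<in> reduced_words k w N"
  then show "x \<in> reduced_words k w M"
    unfolding reduced_words_def using subset_trans[OF _ atLeast_subset_iff[THEN iffD2, of M N]] by blast
qed

text \<open>The bound \<open>M\<close> may depend on \<open>x\<close>, as in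
  \<open>filter_mult\<close>, where the second factor is taken far out after the first is
  fixed.\<close>

lemma reduced_words_map_add:
  assumes w: "w \<in> var_word_seqs k" and x: "x \<in> reduced_words k w N" "1 \<le> N"
  obtains M where "1 \<le> M" "\<And>y. y \<in> reduced_words k w M \<Longrightarrow> x ++ y \<in> reduced_words k w N \<and>
     (Upsilon \<in> ran (x ++ y) \<longleftrightarrow> Upsilon \<in> ran x \<or> Upsilon \<in> ran y)"
proof -
  obtain ns p where *: "x = star w ns p" "ns \<noteq> []" "sorted_wrt (<) ns" "set ns \<subseteq> {N..}"
     "\<forall>n\<in>set ns. p n \<in> insert Upsilon (alphabet k n)"
    using x by (auto simp: reduced_words_def)
  define M where "M = Suc (Max (set ns))"
  have lt: "n < M" if "n \<in> set ns" for n using that by (simp add: M_def less_Suc_eq_le)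
  have "hd ns \<in> {N..}" using *(2,4) hd_in_set by blast
  then have "N \<le> M" using lt[of "hd ns"] *(2) by simp
  show thesis
  proof (rule that)
    show "1 \<le> M" by (simp add: M_def)
    fix y assume "y \<in> reduced_words k w M"
    then obtain ms q where y: "y = star w ms q" "ms \<noteq> []" "sorted_wrt (<) ms" "set ms \<subseteq> {M..}"
       "\<forall>n\<in>set ms. q n \<in> insert Upsilon (alphabet k n)"
      by (auto simp: reduced_words_def)
    \<comment> \<open>The two index lists are separated by \<open>M\<close>, so one assignment of
      letters serves both factors.\<close>
    define r where "r n = (if n < M then p n else q n)" for n
    have xr: "x = star w ns r" unfolding *(1) by (rule star_cong) (simp add: r_def lt)
    have yr: "y = star w ms r" unfolding y(1) by (rule star_cong) (use y(4) in \<open>force simp: r_def\<close>)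
    have xy: "x ++ y = star w (ns @ ms) r" by (simp add: xr yr star_append)
    have s: "sorted_wrt (<) (ns @ ms)"
      using *(3) y(3,4) lt by (force simp: sorted_wrt_append)
    have sub: "set (ns @ ms) \<subseteq> {N..}" using *(4) y(4) \<open>N \<le> M\<close> by auto
    have "\<forall>n\<in>set (ns @ ms). r n \<in> insert Upsilon (alphabet k n)"
      using *(5) y(4,5) lt by (force simp: r_def)
    then have "x ++ y \<in> reduced_words k w N"
      unfolding reduced_words_def xy using s sub *(2) by blast
    moreover have "Upsilon \<in> ran (x ++ y) \<longleftrightarrow> Upsilon \<in> ran x \<or> Upsilon \<in> ran y"
    proof -
      have "set ns \<subseteq> {1..}" "set ms \<subseteq> {1..}" "set (ns @ ms) \<subseteq> {1..}" using sub x(2) by auto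
      then show ?thesis unfolding xy unfolding xr yr
        using Upsilon_in_ran_star[OF w] by (metis Un_iff set_append)
    qed
    ultimately show "x ++ y \<in> reduced_words k w N \<and>
     (Upsilon \<in> ran (x ++ y) \<longleftrightarrow> Upsilon \<in> ran x \<or> Upsilon \<in> ran y)" ..
  qed
qed

lemma reduced_words_subst:
  assumes k: "mono_on {1..} k" and "x \<in> reduced_words k w N" "1 \<le> N" "1 \<le> i" "i \<le> k N"
  shows "subst x (Digit i) \<in> reduced_words k w N"
proof -
  obtain ns p where *: "x = star w ns p" "ns \<noteq> []" "sorted_wrt (<) ns" "set ns \<subseteq> {N..}"
     "\<forall>n\<in>set ns. p n \<in> insert Upsilon (alphabet k n)"
    using assms(2) by (auto simp: reduced_words_def)
  have "Digit i \<in> alphabet k n" if "n \<in> set ns" for n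
  proof -
    have "k N \<le> k n" using mono_onD[OF k, of N n] that *(4) \<open>1 \<le> N\<close> by auto
    then show ?thesis using assms(4,5) by (simp add: alphabet_def)
  qed
  with * show ?thesis
    unfolding reduced_words_def *(1) subst_star
    by (intro CollectI exI[of _ ns] exI[of _ "\<lambda>n. if p n = Upsilon then Digit i else p n"]) auto
qed

text \<open>
  The limits at infinity of variable words (\<open>b = True\<close>) and of constant words (\<open>b = False\<close>).
\<close>

definition word_filter :: "(nat \<Rightarrow> nat) \<Rightarrow> (nat \<Rightarrow> word) \<Rightarrow> bool \<Rightarrow> word filter" where
  "word_filter k w b = (INF N\<in>{1..}. principal {x \<in> reduced_words k w N. (Upsilon \<in> ran x) = b})"

lemma eventually_word_filter:
  "eventually P (word_filter k w b) \<longleftrightarrow>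
     (\<exists>N\<ge>1. \<forall>x\<in>reduced_words k w N. (Upsilon \<in> ran x) = b \<longrightarrow> P x)"
proof -
  let ?F = "\<lambda>N. principal {x \<in> reduced_words k w N. (Upsilon \<in> ran x) = b}"
  have "eventually P (word_filter k w b) \<longleftrightarrow> (\<exists>N\<in>{1..}. eventually P (?F N))"
    unfolding word_filter_def
  proof (rule eventually_INF_base)
    fix M N :: nat assume "M \<in> {1..}" "N \<in> {1..}"
    then show "\<exists>K\<in>{1..}. ?F K \<le> inf (?F M) (?F N)"
      using reduced_words_mono[of M "max M N" k w] reduced_words_mono[of N "max M N" k w]
      by (intro bexI[of _ "max M N"]) auto
  qed auto
  then show ?thesis by (auto simp: eventually_principal Bex_def)
qed

lemma word_filter_not_bot:
  assumes w: "w \<in> var_word_seqs k" and k: "\<forall>n\<ge>1. 1 \<le> k n"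
  shows "word_filter k w b \<noteq> bot"
proof
  assume "word_filter k w b = bot"
  then have "eventually (\<lambda>_. False) (word_filter k w b)" by simp
  then obtain N where N: "N \<ge> 1" "\<forall>x\<in>reduced_words k w N. (Upsilon \<in> ran x) \<noteq> b"
    unfolding eventually_word_filter by blast
  \<comment> \<open>Every tail contains a word with a single index, either \<open>w N\<close> itself
    or its substitution by the letter 1.\<close>
  define p where "p = (\<lambda>n::nat. if b then Upsilon else Digit 1)"
  have "star w [N] p \<in> reduced_words k w N"
    unfolding reduced_words_def using k N(1)
    by (intro CollectI exI[of _ "[N]"] exI[of _ p]) (auto simp: p_def alphabet_def)
  moreover have "Upsilon \<in> ran (star w [N] p) \<longleftrightarrow> b"
    using Upsilon_in_ran_star[OF w, of "[N]" p] N(1) by (simp add: p_def)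
  ultimately show False using N(2) by blast
qed

interpretation words: semigroup "(++) :: word \<Rightarrow> word \<Rightarrow> word"
  by unfold_locales simp

text \<open>A product contains the variable iff one of its factors does. The four choices of
  \<open>a\<close> and \<open>b\<close> give the four closure conditions of
  \<open>substitution_ultrafilters\<close>.\<close>

lemma word_filter_mult:
  assumes w: "w \<in> var_word_seqs k"
  shows "words.filter_mult (word_filter k w a) (word_filter k w b) \<le> word_filter k w (a \<or> b)"
proof (rule filter_leI)
  fix P assume "eventually P (word_filter k w (a \<or> b))"
  then obtain N where N: "1 \<le> N" "\<And>x. x \<in> reduced_words k w N \<Longrightarrow> (Upsilon \<in> ran x) = (a \<or> b) \<Longrightarrow> P x"
    unfolding eventually_word_filter by blast
  have "\<forall>\<^sub>F y in word_filter k w b. P (x ++ y)" if x: "x \<in> reduced_words k w N" "(Upsilon \<in> ran x) = a" for x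
  proof -
    obtain M where "1 \<le> M" "\<And>y. y \<in> reduced_words k w M \<Longrightarrow> x ++ y \<in> reduced_words k w N \<and>
     (Upsilon \<in> ran (x ++ y) \<longleftrightarrow> Upsilon \<in> ran x \<or> Upsilon \<in> ran y)"
      using reduced_words_map_add[OF w x(1) N(1)] by blast
    then show ?thesis unfolding eventually_word_filter using N(2) x(2) by (intro exI[of _ M]) auto
  qed
  then show "eventually P (words.filter_mult (word_filter k w a) (word_filter k w b))"
    unfolding words.eventually_filter_mult eventually_word_filter[of _ k w a] using N(1) by blast
qed

text \<open>The letter \<open>i\<close> need not be allowed at small indices: dropping all words
  with indices below \<open>n\<close> makes it admissible everywhere, since \<open>k\<close> is
  increasing.\<close>

lemma filtermap_subst_word_filter:
  assumes k: "mono_on {1..} k" and i: "1 \<le> i" "1 \<le> n" "i \<le> k n"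
  shows "filtermap (\<lambda>x. subst x (Digit i)) (word_filter k w b) \<le> word_filter k w False"
proof (rule filter_leI)
  fix P assume "eventually P (word_filter k w False)"
  then obtain N where N: "1 \<le> N" "\<And>x. x \<in> reduced_words k w N \<Longrightarrow> Upsilon \<notin> ran x \<Longrightarrow> P x"
    unfolding eventually_word_filter by auto
  let ?M = "max n N"
  have "i \<le> k ?M" using mono_onD[OF k, of n ?M] i by simp
  then have "P (subst x (Digit i))" if "x \<in> reduced_words k w ?M" for x
    using reduced_words_subst[OF k that] i N reduced_words_mono[of N ?M k w]
    by (intro N(2)) (auto simp: Upsilon_in_ran_subst)
  then show "eventually P (filtermap (\<lambda>x. subst x (Digit i)) (word_filter k w b))"
    unfolding eventually_filtermap eventually_word_filter using N(1) by (intro exI[of _ ?M]) auto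
qed

subsection \<open>Integers as words\<close>

lemma g_map_add:
  assumes "finite (dom x)" "finite (dom y)" "dom x \<inter> dom y = {}"
  shows "g k (x ++ y) = g k x + g k y"
proof -
  have "the ((x ++ y) s) = the (x s)" if "s \<in> dom x" for s
    using that assms(3) by (metis disjoint_iff map_add_dom_app_simps(3))
  moreover have "the ((x ++ y) s) = the (y s)" if "s \<in> dom y" for s
    using that by (simp add: map_add_dom_app_simps(1))
  ultimately show ?thesis
    using assms by (simp add: g_def sum.union_disjoint Un_commute[of "dom y"] cong: sum.cong)
qed

lemma g_star:
  assumes w: "w \<in> var_word_seqs k"
  shows "distinct ns \<Longrightarrow> set ns \<subseteq> {1..} \<Longrightarrow> g k (star w ns p) = (\<Sum>n\<in>set ns. g k (subst (w n) (p n)))"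
proof (induction ns)
  case Nil
  show ?case by (simp add: g_def)
next
  case (Cons m ns)
  have fin: "finite (dom (w n))" if "n \<in> set (m # ns)" for n
    using var_word_seq_mem[OF w, of n] that Cons.prems(2) by (auto simp: var_words_def)
  have "dom (w m) \<inter> dom (w n) = {}" if "n \<in> set ns" for n
    using that Cons.prems by (intro var_word_seq_disjoint[OF w]) auto
  then have "g k (star w (m # ns) p) = g k (subst (w m) (p m)) + g k (star w ns p)"
    using fin unfolding star_Cons by (intro g_map_add) (auto simp: dom_star)
  with Cons show ?case by simp
qed

lemma l_dvd: "i \<le> j \<Longrightarrow> l k i dvd l k j"
  unfolding l_def by (rule prod_dvd_prod_subset) auto

lemma l_pos: "0 < l k s"
  by (simp add: l_def prod_pos)

text \<open>The lowest nonzero coefficient \<open>e j\<close> would be a multiple of \<open>k (Suc j) + 1\<close>.\<close>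

lemma alternating_radix_eq_0:
  fixes e :: "nat \<Rightarrow> int"
  assumes bound: "\<And>j. j < N \<Longrightarrow> \<bar>e j\<bar> \<le> int (k (Suc j))"
    and sum: "(\<Sum>j<N. e j * (-1) ^ j * int (l k j)) = 0"
  shows "j < N \<Longrightarrow> e j = 0"
proof (induction j rule: less_induct)
  case (less j)
  let ?t = "\<lambda>j. e j * (-1) ^ j * int (l k j)"
  have "(\<Sum>j<N. ?t j) = (\<Sum>i<j. ?t i) + (\<Sum>i\<in>{j..<N}. ?t i)"
    using less.prems sum.atLeastLessThan_concat[of 0 j N ?t] by (simp add: lessThan_atLeast0)
  then have "(\<Sum>j<N. ?t j) = (\<Sum>i<j. ?t i) + ?t j + (\<Sum>i\<in>{Suc j..<N}. ?t i)"
    using less.prems by (simp add: sum.atLeast_Suc_lessThan)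
  moreover have "(\<Sum>i<j. ?t i) = 0" using less by (intro sum.neutral) auto
  \<comment> \<open>The terms below \<open>j\<close> vanish by induction and those above are
    divisible by \<open>l k (Suc j)\<close>, so the term at \<open>j\<close> is divisible by it as
    well.\<close>
  moreover have "int (l k (Suc j)) dvd (\<Sum>i\<in>{Suc j..<N}. ?t i)"
    by (intro dvd_sum dvd_mult) (auto intro: l_dvd simp flip: of_nat_dvd_iff)
  ultimately have "int (l k (Suc j)) dvd ?t j"
    using sum by (simp add: add_eq_0_iff2)
  then have "int (l k (Suc j)) dvd e j * int (l k j)"
    by (cases "even j") auto
  moreover have "int (l k (Suc j)) = (int (k (Suc j)) + 1) * int (l k j)"
    by (simp add: l_def algebra_simps)
  ultimately have "int (k (Suc j)) + 1 dvd e j" using l_pos[of k j] by simp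
  then show ?case using bound[OF less.prems] dvd_imp_le_int[of "e j" "int (k (Suc j)) + 1"] by linarith
qed

text \<open>The digit differences of two words with equal value are bounded by \<open>k\<close>, so
  \<open>alternating_radix_eq_0\<close> makes them vanish. The empty word is included in order to
  obtain that \<open>g\<close> is nonzero on words.\<close>

lemma inj_on_g: "inj_on (g k) (insert Map.empty (words k))"
proof (rule inj_onI)
  fix x y assume x: "x \<in> insert Map.empty (words k)" and y: "y \<in> insert Map.empty (words k)"
    and eq: "g k x = g k y"
  define c where "c x s = (case x s of None \<Rightarrow> 0 | Some a \<Rightarrow> int (digit a))" for x :: word and s
  have fin: "finite (dom x \<union> dom y)" using x y by (auto simp: words_def)
  define N where "N = Max (insert 0 (dom x \<union> dom y))"
  have le: "s \<le> N" if "s \<in> dom x \<union> dom y" for s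
    unfolding N_def using fin that by (intro Max_ge) auto
  have pos: "1 \<le> s" if "s \<in> dom x \<union> dom y" for s using that x y by (auto simp: words_def)
  have g: "g k u = (\<Sum>j<N. c u (Suc j) * (-1) ^ j * int (l k j))" if "dom u \<subseteq> dom x \<union> dom y" for u
  proof -
    have "g k u = (\<Sum>s\<in>dom u. c u s * (-1) ^ (s - 1) * int (l k (s - 1)))"
      unfolding g_def c_def by (rule sum.cong) auto
    also have "\<dots> = (\<Sum>s=1..N. c u s * (-1) ^ (s - 1) * int (l k (s - 1)))"
      using that le pos by (intro sum.mono_neutral_left) (auto simp: c_def subset_iff split: option.split)
    also have "\<dots> = (\<Sum>j<N. c u (Suc j) * (-1) ^ j * int (l k j))"
      using sum.shift_bounds_Suc_ivl[of "\<lambda>s. c u s * (-1) ^ (s - 1) * int (l k (s - 1))" 0 N]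
      by (simp add: atLeastLessThanSuc_atLeastAtMost lessThan_atLeast0)
    finally show ?thesis .
  qed
  have c: "0 \<le> c u s \<and> c u s \<le> int (k s)" if "u \<in> insert Map.empty (words k)" for u s
    using that by (cases "u s") (force simp: c_def words_def alphabet_def)+
  have "(\<Sum>j<N. (c x (Suc j) - c y (Suc j)) * (-1) ^ j * int (l k j)) = 0"
    using eq g[of x] g[of y] by (simp add: left_diff_distrib sum_subtractf)
  then have "c x (Suc j) - c y (Suc j) = 0" if "j < N" for j
    using that by (rule alternating_radix_eq_0[rotated]) (use c[OF x] c[OF y] in \<open>smt (verit)\<close>)
  then have cc: "c x s = c y s" if "s \<in> dom x \<union> dom y" for s
    using le[OF that] pos[OF that] by (cases s) auto
  \<comment> \<open>Digits are at least 1, so the coefficient 0 occurs only outside the domain and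
    the coefficients determine the word.\<close>
  have dig: "\<exists>a\<ge>1. u s = Some (Digit a)" if "u \<in> insert Map.empty (words k)" "s \<in> dom u" for u s
  proof -
    have "u \<in> words k" using that by auto
    then have "the (u s) \<in> Digit ` {1..k s}" using that(2) by (simp add: words_def alphabet_def)
    with that(2) show ?thesis by auto
  qed
  show "x = y"
  proof
    fix s show "x s = y s"
      using cc[of s] dig[OF x, of s] dig[OF y, of s] by (cases "x s"; cases "y s") (auto simp: c_def dom_def)
  qed
qed

lemma g_inv_g: "x \<in> words k \<Longrightarrow> g_inv k (g k x) = x"
  unfolding g_inv_def using inj_on_g by (intro inv_into_f_f) (auto intro: inj_on_subset)

lemma g_neq_0:
  assumes "x \<in> words k"
  shows "g k x \<noteq> 0"
proof
  assume "g k x = 0"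
  then have "g k x = g k Map.empty" by (simp add: g_def)
  then have "x = Map.empty" by (rule inj_onD[OF inj_on_g]) (use assms in auto)
  with assms show False by (simp add: words_def)
qed

subsection \<open>Convergence along an extraction\<close>

text \<open>Products are built from the right: the tail uses indices beyond \<open>n\<close> and
  lies in \<open>G (Suc n)\<close>, and prefixing a substituted \<open>u n\<close> leads into
  \<open>G n\<close>.\<close>

lemma star_in_nested_sets:
  assumes G: "\<And>n x. G (Suc n) x \<Longrightarrow> G n x"
    and 1: "\<And>n i. 1 \<le> n \<Longrightarrow> i \<in> {1..k n} \<Longrightarrow> G n (subst (u n) (Digit i))"
    and 2: "\<And>n i x. 1 \<le> n \<Longrightarrow> i \<in> {1..k n} \<Longrightarrow> G (Suc n) x \<Longrightarrow> G n (subst (u n) (Digit i) ++ x)"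
  shows "\<lbrakk>ns \<noteq> []; sorted_wrt (<) ns; set ns \<subseteq> {N..}; 1 \<le> N; \<forall>n\<in>set ns. p n \<in> alphabet k n\<rbrakk>
    \<Longrightarrow> G N (star u ns p)"
proof (induction ns arbitrary: N)
  case (Cons n ns)
  have antimono: "G b x \<Longrightarrow> a \<le> b \<Longrightarrow> G a x" for a b x
    by (rule dec_induct[of a b "\<lambda>b. G b x \<longrightarrow> G a x", rule_format]) (auto intro: G)
  obtain i where i: "p n = Digit i" "i \<in> {1..k n}" using Cons.prems by (auto simp: alphabet_def)
  have n: "1 \<le> n" "N \<le> n" using Cons.prems by auto
  have "G n (star u (n # ns) p)"
  proof (cases "ns = []")
    case True
    then show ?thesis using 1[OF n(1) i(2)] i by simp
  next
    case False
    have "set ns \<subseteq> {Suc n..}" using Cons.prems(2) by auto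
    then have "G (Suc n) (star u ns p)" using Cons.IH[OF False, of "Suc n"] Cons.prems by auto
    then show ?thesis using 2[OF n(1) i(2)] i by simp
  qed
  then show ?case using n(2) by (rule antimono)
qed simp

text \<open>By compactness \<open>f\<close> has a limit along \<open>p\<close>; the balls of radius
  1/(n+1) around it are the targets of the Galvin-Glazer recursion. The dynamics enter only later,
  through the choice of \<open>f\<close>.\<close>

lemma (in Metric_space) convergent_extraction:
  fixes f :: "word \<Rightarrow> 'a"
  assumes "compact_space mtopology" and w: "w \<in> var_word_seqs k"
    and k: "mono_on {1..} k" "\<forall>n\<ge>1. 1 \<le> k n" and f: "\<And>x. x \<in> words k \<Longrightarrow> f x \<in> M"
  obtains u a where "u \<in> var_word_seqs k" "\<And>n. 1 \<le> n \<Longrightarrow> u n \<in> extracted_words k w" "a \<in> M"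
    "\<And>N ns p. \<lbrakk>ns \<noteq> []; sorted_wrt (<) ns; set ns \<subseteq> {N..}; 1 \<le> N;
       \<forall>n\<in>set ns. p n \<in> alphabet k n\<rbrakk> \<Longrightarrow> f (star u ns p) \<in> mball a (inverse (Suc N))"
proof -
  \<comment> \<open>The recursion starts at 0 but the sequences at 1, so index 0 imposes no
    substitution. The union of all \<open>I n\<close> is used next: one pair \<open>p\<close>,
    \<open>q\<close> serves all letters, even when \<open>k\<close> is unbounded.\<close>
  define I where "I n = (if n = 0 then {} else {1..k n})" for n
  obtain p q where p: "ultrafilter p" "p \<le> word_filter k w False" "words.filter_mult p p = p"
    and q: "ultrafilter q" "q \<le> word_filter k w True"
    and pq: "\<And>i. i \<in> \<Union> (range I) \<Longrightarrow> filtermap (\<lambda>x. subst x (Digit i)) q = p"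
  proof (rule words.substitution_ultrafilters[of "word_filter k w False" "word_filter k w True"
        "\<lambda>i x. subst x (Digit i)" "\<Union> (range I)"])
    show "word_filter k w False \<noteq> bot" "word_filter k w True \<noteq> bot"
      using word_filter_not_bot[OF w k(2)] by blast+
    show "words.filter_mult (word_filter k w False) (word_filter k w False) \<le> word_filter k w False"
      "words.filter_mult (word_filter k w False) (word_filter k w True) \<le> word_filter k w True"
      "words.filter_mult (word_filter k w True) (word_filter k w False) \<le> word_filter k w True"
      "words.filter_mult (word_filter k w True) (word_filter k w True) \<le> word_filter k w True"
      using word_filter_mult[OF w, of False False] word_filter_mult[OF w, of False True]
        word_filter_mult[OF w, of True False] word_filter_mult[OF w, of True True] by simp_all
    show "filtermap (\<lambda>x. subst x (Digit i)) (word_filter k w True) \<le> word_filter k w False"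
      if "i \<in> \<Union> (range I)" for i
    proof -
      from that obtain n where "i \<in> I n" by blast
      then have "1 \<le> i" "1 \<le> n" "i \<le> k n" by (auto simp: I_def split: if_splits)
      then show ?thesis using filtermap_subst_word_filter[OF k(1)] by blast
    qed
    show "\<forall>\<^sub>F x in word_filter k w False. subst x (Digit i) = x" for i
      unfolding eventually_word_filter by (intro exI[of _ 1]) (simp add: subst_id)
  qed (simp add: subst_map_add, blast intro: that)
  have "\<forall>\<^sub>F x in word_filter k w False. x \<in> words k"
    unfolding eventually_word_filter using reduced_words_cases[OF w k(1)] by (intro exI[of _ 1]) force
  then have "\<forall>\<^sub>F x in p. x \<in> words k" using p(2) filter_leD by blast
  then have "\<forall>\<^sub>F x in p. f x \<in> topspace mtopology" using f by (auto elim: eventually_mono)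
  then obtain a where a: "a \<in> M" "limitin mtopology f a p"
    using ultrafilter_limit[OF assms(1) p(1)] by auto
  have q_ev: "eventually P q" if "1 \<le> N" "\<And>x. x \<in> reduced_words k w N \<Longrightarrow> Upsilon \<in> ran x \<Longrightarrow> P x" for P N
    using that filter_leD[OF q(2), of P] unfolding eventually_word_filter by blast
  \<comment> \<open>The order relation is made conditional because it has to hold
    \<open>q\<close>-eventually for every \<open>x\<close>, also for one with empty or infinite
    domain.\<close>
  obtain u G where u: "\<And>n. u n \<in> reduced_words k w 1 \<and> Upsilon \<in> ran (u n)"
      "\<And>n. finite (dom (u n)) \<longrightarrow> dom (u n) \<noteq> {} \<longrightarrow> word_less (u n) (u (Suc n))"
    and G: "\<And>n x. G n x \<Longrightarrow> f x \<in> mball a (inverse (Suc n))"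
    "\<And>n x. G (Suc n) x \<Longrightarrow> G n x" "\<And>n i. i \<in> I n \<Longrightarrow> G n (subst (u n) (Digit i))"
    "\<And>n i x. i \<in> I n \<Longrightarrow> G (Suc n) x \<Longrightarrow> G n (subst (u n) (Digit i) ++ x)"
  proof (rule words.substitution_sequence[of p q I "\<lambda>i x. subst x (Digit i)"
        "\<lambda>n x. f x \<in> mball a (inverse (Suc n))" "\<lambda>n x. x \<in> reduced_words k w 1 \<and> Upsilon \<in> ran x"
        "\<lambda>x y. finite (dom x) \<longrightarrow> dom x \<noteq> {} \<longrightarrow> word_less x y"])
    show "q \<noteq> bot" using q(1) by (simp add: ultrafilter_def)
    show "\<forall>\<^sub>F x in p. f x \<in> mball a (inverse (Suc n))" for n
      using a by (simp add: limitin_def del: in_mball)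
    show "\<forall>\<^sub>F x in q. x \<in> reduced_words k w 1 \<and> Upsilon \<in> ran x"
      using q_ev[of 1] by simp
    show "\<forall>\<^sub>F y in q. finite (dom x) \<longrightarrow> dom x \<noteq> {} \<longrightarrow> word_less x y" for x
    proof (cases "finite (dom x)")
      case True
      define N where "N = Suc (Max (insert 0 (dom x)))"
      have lt: "s < N" if "s \<in> dom x" for s using that True by (simp add: N_def less_Suc_eq_le)
      have N: "1 \<le> N" by (simp add: N_def)
      show ?thesis
      proof (rule q_ev[OF N], intro impI word_lessI)
        fix y s t assume "y \<in> reduced_words k w N" "s \<in> dom x" "t \<in> dom y"
        then show "s < t" using lt reduced_words_dom(3)[OF w _ N, of y] by fastforce
      qed (use reduced_words_dom[OF w _ N] in auto)
    qed simp
    show "filtermap (\<lambda>x. subst x (Digit i)) q = p" if "i \<in> I n" for i n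
      using that by (blast intro: pq)
    show "finite (I n)" for n by (simp add: I_def)
  qed (use p(3) that in blast)+
  have "u n \<in> var_words k" for n
    using reduced_words_cases[OF w k(1), of "u n" 1] u(1)[of n] by simp
  then have "u \<in> var_word_seqs k"
    using u(2) by (simp add: var_word_seqs_def var_words_def)
  moreover have "u n \<in> extracted_words k w" for n
    using reduced_words_extracted[OF w _ order_refl] u(1)[of n] by blast
  moreover have "f (star u ns p) \<in> mball a (inverse (Suc N))"
    if "ns \<noteq> []" "sorted_wrt (<) ns" "set ns \<subseteq> {N..}" "1 \<le> N" "\<forall>n\<in>set ns. p n \<in> alphabet k n" for N ns p
    using star_in_nested_sets[of G k u, OF G(2) _ _ that] G(1,3,4) by (simp add: I_def)
  ultimately show thesis using that a(1) by blast
qed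

section \<open>The two uniform limits\<close>

theorem theorem3p4:
  fixes k :: "nat \<Rightarrow> nat"
    and X :: "'a set" and d :: "'a \<Rightarrow> 'a \<Rightarrow> real"
    and T :: "int \<Rightarrow> 'a \<Rightarrow> 'a"
    and z :: "nat \<Rightarrow> nat \<Rightarrow> int"
    and y :: 'a
  assumes "mono_on {1..} k" and "\<forall>n\<ge>1. 2 \<le> k n"
    and "Metric_space X d" and "compact_space (Metric_space.mtopology X d)"
    and "Z_system k (Metric_space.mtopology X d) T"
    and "z \<in> Z_inf k" and "y \<in> X"
  shows "\<exists>v x0. is_extraction k v z \<and> x0 \<in> X \<and>
           R2_lim_uniformly k (Metric_space.mtopology X d) (index_seqs k)
             (\<lambda>i. FS (\<lambda>n. v n (i n))) (\<lambda>m. T m y) x0 \<and>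
           R2_lim_uniformly k (Metric_space.mtopology X d) (index_seqs k)
             (\<lambda>i. FS (\<lambda>n. v n (i n))) (\<lambda>m. T m x0) x0"
proof -
  interpret Metric_space X d by fact
  note k = \<open>mono_on {1..} k\<close>
  have k1: "\<forall>n\<ge>1. 1 \<le> k n" using assms(2) by fastforce
  obtain w where w: "w \<in> var_word_seqs k" "\<forall>n\<ge>1. z n = g_var k (w n)"
    using assms(6) by (auto simp: Z_inf_def)
  have cont: "continuous_map mtopology mtopology (T m)" if "m \<noteq> 0" for m
    using assms(5) that by (simp add: Z_system_def)
  have TX: "T m x \<in> X" if "m \<noteq> 0" "x \<in> X" for m x
    using cont[OF that(1)] that(2) by (auto simp: continuous_map_def)
  obtain u a where u: "u \<in> var_word_seqs k" and ext: "\<And>n. 1 \<le> n \<Longrightarrow> u n \<in> extracted_words k w"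
    and a: "a \<in> X" and conv: "\<And>N ns p. \<lbrakk>ns \<noteq> []; sorted_wrt (<) ns; set ns \<subseteq> {N..}; 1 \<le> N;
       \<forall>n\<in>set ns. p n \<in> alphabet k n\<rbrakk> \<Longrightarrow> T (g k (star u ns p)) y \<in> mball a (inverse (Suc N))"
    using convergent_extraction[OF assms(4) w(1) k k1, of "\<lambda>x. T (g k x) y"] TX g_neq_0 assms(7)
    by blast
  define v where "v n = g_var k (u n)" for n
  have extr: "is_extraction k v z"
    unfolding is_extraction_def v_def using u w ext by blast
  \<comment> \<open>The set \<open>FS\<close> is indexed by integers. Injectivity of
    \<open>g\<close> recovers the word of a sum, and a word starting no earlier than
    \<open>u N\<close> uses only indices from \<open>N\<close> on.\<close>
  have FS_star: "\<exists>ns p. m = g k (star u ns p) \<and> star u ns p \<in> words k \<and> ns \<noteq> [] \<and>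
      sorted_wrt (<) ns \<and> set ns \<subseteq> {N..} \<and> (\<forall>n\<in>set ns. p n \<in> alphabet k n)"
    if i: "i \<in> index_seqs k" and m: "m \<in> FS (\<lambda>n. v n (i n))" and N: "1 \<le> N"
      and min: "Min (dom (u N)) \<le> Min (dom (g_inv k m))" for i m N
  proof -
    obtain F where F: "finite F" "F \<noteq> {}" "F \<subseteq> {1..}" "m = (\<Sum>n\<in>F. v n (i n))"
      using m by (auto simp: FS_def)
    define ns where "ns = sorted_list_of_set F"
    define p where "p n = Digit (i n)" for n
    have ns: "ns \<noteq> []" "sorted_wrt (<) ns" "set ns = F" "distinct ns"
      using F by (auto simp: ns_def)
    have p: "\<forall>n\<in>set ns. p n \<in> alphabet k n"
      using i F(3) unfolding ns(3) by (auto simp: p_def alphabet_def index_seqs_def)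
    have dom: "finite (dom (u n))" "dom (u n) \<noteq> {}" if "1 \<le> n" for n
      using var_word_seq_mem[OF u that] by (auto simp: var_words_def)
    \<comment> \<open>\<open>g_var\<close> is meaningful only up to \<open>k\<close> at the minimum
      of the domain, which is at least \<open>n\<close>; hence \<open>i n\<close> is within
      range.\<close>
    have "v n (i n) = g k (subst (u n) (p n))" if "n \<in> F" for n
    proof -
      have n: "1 \<le> n" using that F(3) by auto
      have "n \<le> Min (dom (u n))" using var_word_seq_ge[OF u n] dom[OF n] by simp
      then have "k n \<le> k (Min (dom (u n)))" using mono_onD[OF k, of n] n by simp
      moreover have "1 \<le> i n" "i n \<le> k n" using i n by (auto simp: index_seqs_def)
      ultimately show ?thesis by (simp add: v_def g_var_def p_def)
    qed
    then have m: "m = g k (star u ns p)"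
      using F(3,4) ns g_star[OF u, of ns p] by simp
    have words: "star u ns p \<in> words k"
      using star_in_words[OF u k ns(1) _ p] F(3) ns(3) by simp
    have "N \<le> n" if n: "n \<in> F" for n
    proof (rule ccontr)
      assume "\<not> N \<le> n"
      then have "n < N" by simp
      have n1: "1 \<le> n" using n F(3) by auto
      obtain s where s: "s \<in> dom (u n)" using dom(2)[OF n1] by blast
      have "s \<in> dom (star u ns p)" unfolding dom_star ns(3) using n s by blast
      moreover have "finite (dom (star u ns p))" using words by (simp add: words_def)
      ultimately have "Min (dom (star u ns p)) \<le> s" by simp
      moreover have "s < Min (dom (u N))"
        using dom[OF N] var_word_seq_less[OF u n1 \<open>n < N\<close> s] by simp
      ultimately show False using min unfolding m g_inv_g[OF words] by simp
    qed
    then have "set ns \<subseteq> {N..}" using ns(3) by auto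
    with m words ns p show ?thesis by blast
  qed
  have near: "T m y \<in> mball a (inverse (Suc N)) \<and> T m a \<in> mcball a (inverse (Suc N))"
    if i: "i \<in> index_seqs k" and m: "m \<in> FS (\<lambda>n. v n (i n))" and N: "1 \<le> N"
      and min: "Min (dom (u N)) \<le> Min (dom (g_inv k m))" for i m N
  proof
    obtain ns p where *: "m = g k (star u ns p)" "star u ns p \<in> words k" "ns \<noteq> []"
      "sorted_wrt (<) ns" "set ns \<subseteq> {N..}" "\<forall>n\<in>set ns. p n \<in> alphabet k n"
      using FS_star[OF i m N min] by blast
    show "T m y \<in> mball a (inverse (Suc N))" unfolding *(1) using * N by (intro conv)
    have m0: "m \<noteq> 0" unfolding *(1) using *(2) by (rule g_neq_0)
    \<comment> \<open>The default letter 1 extends the assignment beyond \<open>ns\<close>, so that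
      the word of \<open>m\<close> and the later words \<open>u n\<close> with variable replaced by
      1 share one assignment.\<close>
    define q where "q n = (if n \<in> set ns then p n else Digit 1)" for n
    have q: "star u ns p = star u ns q" by (rule star_cong) (simp add: q_def)
    have alph: "q n \<in> alphabet k n" if "1 \<le> n" for n
      using *(6) k1 that by (auto simp: q_def alphabet_def)
    define c where "c n = g k (star u [n] q)" for n
    have far: "T (c n) y \<in> mball a (inverse (Suc n))" if "1 \<le> n" for n
      unfolding c_def using that alph by (intro conv) auto
    have "limitin mtopology (\<lambda>n. T (c n) y) a sequentially"
      unfolding limitin_metric
    proof (intro conjI allI impI)
      fix \<epsilon> :: real assume "0 < \<epsilon>"
      then obtain n0 where n0: "inverse (real (Suc n0)) < \<epsilon>" using reals_Archimedean by blast
      show "\<forall>\<^sub>F n in sequentially. T (c n) y \<in> X \<and> d (T (c n) y) a < \<epsilon>"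
      proof (rule eventually_sequentiallyI[of "Suc n0"])
        fix n assume n: "Suc n0 \<le> n"
        then have "inverse (real (Suc n)) \<le> inverse (real (Suc n0))" by simp
        then have "inverse (real (Suc n)) < \<epsilon>" using n0 by linarith
        with far[of n] n show "T (c n) y \<in> X \<and> d (T (c n) y) a < \<epsilon>"
          by (simp add: commute)
      qed
    qed (rule a)
    then have lim: "limitin mtopology (\<lambda>n. T m (T (c n) y)) (T m a) sequentially"
      using continuous_map_limit[OF cont[OF m0]] by (auto simp: comp_def)
    \<comment> \<open>For \<open>n\<close> beyond \<open>ns\<close> the system property gives
      \<open>T (m + c n) y\<close>. The sum \<open>m + c n\<close> belongs to the index list
      \<open>ns @ [n]\<close>, still within \<open>{N..}\<close>, so \<open>conv\<close> applies;
      the limit in \<open>n\<close> then lies in the closed ball.\<close>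
    have "T m (T (c n) y) \<in> mcball a (inverse (Suc N))" if n: "Suc (Max (set ns)) \<le> n" for n
    proof -
      have lt: "r < n" if "r \<in> set ns" for r
        using n Max_ge[OF finite_set that] by linarith
      have Nn: "N \<le> n" using lt[of "hd ns"] hd_in_set[OF *(3)] *(5) by force
      have n1: "1 \<le> n" using Nn N by simp
      have sub: "set (ns @ [n]) \<subseteq> {N..}" using *(5) Nn by auto
      then have sub1: "set (ns @ [n]) \<subseteq> {1..}" using N by auto
      have sorted: "sorted_wrt (<) (ns @ [n])" using *(4) lt by (simp add: sorted_wrt_append)
      then have dist: "distinct (ns @ [n])" using strict_sorted_iff by blast
      have cw: "star u [n] q \<in> words k" using alph n1 by (intro star_in_words[OF u k]) auto
      have sum: "m + c n = g k (star u (ns @ [n]) q)"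
        using dist sub1 unfolding *(1) q c_def by (simp add: g_star[OF u])
      have "word_less (star u ns p) (star u [n] q)"
      proof (rule word_lessI)
        fix s t assume "s \<in> dom (star u ns p)" "t \<in> dom (star u [n] q)"
        then obtain r where r: "r \<in> set ns" "s \<in> dom (u r)" "t \<in> dom (u n)" by (auto simp: dom_star)
        then show "s < t" using var_word_seq_less[OF u, of r n s t] sub1 lt by auto
      qed (use *(2) cw in \<open>simp_all only: words_def mem_Collect_eq not_False_eq_True\<close>)
      then have "int_less k m (c n)"
        unfolding int_less_def *(1) c_def using g_inv_g[OF *(2)] g_inv_g[OF cw] by simp
      moreover have "c n \<noteq> 0" unfolding c_def using cw by (rule g_neq_0)
      ultimately have "T m (T (c n) y) = T (m + c n) y"
        using assms(5,7) m0 by (simp add: Z_system_def)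
      moreover have "T (m + c n) y \<in> mball a (inverse (Suc N))"
        unfolding sum using sorted sub N sub1 alph by (intro conv) auto
      ultimately show ?thesis using mball_subset_mcball by auto
    qed
    then show "T m a \<in> mcball a (inverse (Suc N))"
      by (intro limitin_closedin[OF lim closedin_mcball]) (auto intro: eventually_sequentiallyI)
  qed
  \<comment> \<open>Stated with closed balls to cover both limits. The threshold is the start of
    \<open>u (Suc N)\<close>, which does not depend on \<open>i\<close>; this is the
    uniformity.\<close>
  have lim: "R2_lim_uniformly k mtopology (index_seqs k) (\<lambda>i. FS (\<lambda>n. v n (i n))) h a"
    if h: "\<And>i m N. \<lbrakk>i \<in> index_seqs k; m \<in> FS (\<lambda>n. v n (i n)); 1 \<le> N;
       Min (dom (u N)) \<le> Min (dom (g_inv k m))\<rbrakk> \<Longrightarrow> h m \<in> mcball a (inverse (Suc N))" for h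
    unfolding R2_lim_uniformly_def
  proof (intro allI impI)
    fix V assume "\<exists>U. openin mtopology U \<and> a \<in> U \<and> U \<subseteq> V"
    then obtain U where U: "openin mtopology U" "a \<in> U" "U \<subseteq> V" by blast
    then obtain \<epsilon> where "0 < \<epsilon>" "mball a \<epsilon> \<subseteq> U" using openin_mtopology[of U] by blast
    with U have \<epsilon>: "0 < \<epsilon>" "mball a \<epsilon> \<subseteq> V" by auto
    obtain N where "inverse (real (Suc N)) < \<epsilon>" using \<epsilon>(1) reals_Archimedean by blast
    \<comment> \<open>The index passed to \<open>h\<close> is \<open>Suc N\<close>, as it must be at
      least 1; the radius shrinks accordingly.\<close>
    then have "inverse (real (Suc (Suc N))) < \<epsilon>"
      by (rule le_less_trans[rotated]) simp
    then have "mcball a (inverse (Suc (Suc N))) \<subseteq> V"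
      using \<epsilon>(2) by (auto simp: subset_iff)
    then have "\<forall>i\<in>index_seqs k. \<forall>m\<in>FS (\<lambda>n. v n (i n)).
       Min (dom (u (Suc N))) \<le> Min (dom (g_inv k m)) \<longrightarrow> h m \<in> V"
      using h[of _ _ "Suc N"] by auto
    moreover have "1 \<le> Min (dom (u (Suc N)))"
      using var_word_seq_mem[OF u, of "Suc N"] by (auto simp: var_words_def)
    ultimately show "\<exists>n0\<ge>1. \<forall>i\<in>index_seqs k. \<forall>m\<in>FS (\<lambda>n. v n (i n)).
       n0 \<le> Min (dom (g_inv k m)) \<longrightarrow> h m \<in> V"
      by blast
  qed
  show ?thesis
  proof (intro exI conjI)
    show "R2_lim_uniformly k mtopology (index_seqs k) (\<lambda>i. FS (\<lambda>n. v n (i n))) (\<lambda>m. T m y) a"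
      using near[THEN conjunct1] by (intro lim subsetD[OF mball_subset_mcball])
    show "R2_lim_uniformly k mtopology (index_seqs k) (\<lambda>i. FS (\<lambda>n. v n (i n))) (\<lambda>m. T m a) a"
      using near[THEN conjunct2] by (intro lim)
  qed (fact extr a)+
qed

end
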